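(* Let $(\Lambda,\pi)$ be an action operad such that every homomorphism $\pi_n:\Lambda(n)\to\Sigma_n$ is surjective. Then there is a short exact sequence of action operads $$T\to\mathrm{Ker}\,\pi\hookrightarrow\Lambda\xrightarrow{\ \pi\ }\Sigma\to T .$$ In particular, every action operad $\Lambda$ is either an operad in groups or an extension of $\Sigma$ by an operad in groups.
   Context: $\mathbb N\ni 0$; $e_n$ is the identity of $\Lambda(n)$; permutations compose as functions. A (non-symmetric) operad $O$ in sets: sets $O(n)$ ($n\in\mathbb N$), $\mathrm{id}\in O(1)$, functions $\mu:O(n)\times O(k_1)\times\cdots\times O(k_n)\to O(k_1+\cdots+k_n)$, unital and associative in the usual sense; maps preserve $\mathrm{id}$ and $\mu$. The operad $\Sigma$ of symmetric groups has $\mu(\sigma;\tau_1,\dots,\tau_n)=\delta(\sigma)\cdot\beta(\tau_1,\dots,\tau_n)$, with $\beta$ the block sum of permutations $\tau_i\in\Sigma_{k_i}$ and $\delta(\sigma)=\delta_{n;k_1,\dots,k_n}(\sigma)$ sending $k_1+\cdots+k_{i-1}+a$ ($1\le a\le k_i$) to $(\sum_{\sigma(i')<\sigma(i)}k_{i'})+a$. An action operad $(\Lambda,\pi)$: an operad $\Lambda$ in sets with a group structure on each $\Lambda(n)$ and a map of operads $\pi:\Lambda\to\Sigma$ whose components are group homomorphisms, such that, writing $g(i)=\pi_n(g)(i)$, $\mu(g';f_1',\dots,f_n')\mu(g;f_1,\dots,f_n)=\mu(g'g;f'_{g(1)}f_1,\dots,f'_{g(n)}f_n)$ for $g,g'\in\Lambda(n)$,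 $f_i\in\Lambda(k_i)$, $f_i'\in\Lambda(k_{g^{-1}(i)})$. A map of action operads is a map of operads $f:\Lambda\to\Lambda'$ with $\pi^{\Lambda'}f=\pi^{\Lambda}$ and each $f_n$ a homomorphism. $\Sigma$ is an action operad with $\pi=\mathrm{id}$; $T$ is the action operad of trivial groups. The map $\pi:\Lambda\to\Sigma$ is a map of action operads. For a map $f:\Lambda\to\Lambda'$ of action operads, $\mathrm{Ker}\,f$ (resp. $\mathrm{Im}\,f$) is the action operad consisting of the subgroups $\ker f_n\le\Lambda(n)$ (resp. $\mathrm{im}\,f_n\le\Lambda'(n)$), with operad structure and $\pi$ restricted from $\Lambda$ (resp. $\Lambda'$). A short exact sequence $T\to\Lambda_1\xrightarrow{f}\Lambda_2\xrightarrow{g}\Lambda_3\to T$ of action operads consists of maps of action operads $f,g$ with $\mathrm{Ker}\,f=T$, $\mathrm{Im}\,f=\mathrm{Ker}\,g$, $\mathrm{Im}\,g=\Lambda_3$; it exhibits $\Lambda_2$ as an extension of $\Lambda_3$ by $\Lambda_1$. An operad in groups is an operad in the cartesian monoidal category of groups (each $P(n)$ a group, each $\mu$ a homomorphism, $\mathrm{id}=e_1$); it is identified with an action operad all of whose maps $\pi_n$ are trivial, and conversely an action operad with all $\pi_n$ trivial is regarded as an operad in groups. *)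

theory Defs
  imports "HOL-Algebra.Coset" "HOL-Combinatorics.Permutations"
begin

text \<open>
  The sets of an operad live in one type and need not be disjoint for different arities
  (the identity function lies in every symmetric group), so the composition takes the list
  \<open>ks = [k\<^sub>1, \<dots>, k\<^sub>n]\<close> of input arities explicitly; the arity of \<open>g\<close> in \<open>opcomp P ks g fs\<close> is
  \<open>length ks\<close>. Lists are indexed from 0, and accordingly permutations of \<open>n\<close> letters are
  permutations of \<open>{0, \<dots>, n - 1}\<close>.
\<close>

record 'a operad =
  opset :: "nat \<Rightarrow> 'a set"
  opid :: 'a
  opcomp :: "nat list \<Rightarrow> 'a \<Rightarrow> 'a list \<Rightarrow> 'a"

record 'a group_operad = "'a operad" +
  opmult :: "nat \<Rightarrow> 'a \<Rightarrow> 'a \<Rightarrow> 'a"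
  opone :: "nat \<Rightarrow> 'a"

record 'a action_operad = "'a group_operad" +
  operm :: "nat \<Rightarrow> 'a \<Rightarrow> nat \<Rightarrow> nat"

definition opgroup :: "('a, 'm) group_operad_scheme \<Rightarrow> nat \<Rightarrow> 'a monoid" where
  "opgroup P n = \<lparr>carrier = opset P n, monoid.mult = opmult P n, one = opone P n\<rparr>"

definition op_inputs :: "('a, 'm) operad_scheme \<Rightarrow> nat list \<Rightarrow> 'a list set" where
  "op_inputs P ks = {fs. list_all2 (\<lambda>k f. f \<in> opset P k) ks fs}"

locale operad =
  fixes P :: "('a, 'm) operad_scheme"
  assumes opid_closed: "opid P \<in> opset P 1"
    and opcomp_closed:
      "\<lbrakk>g \<in> opset P (length ks); fs \<in> op_inputs P ks\<rbrakk> \<Longrightarrow> opcomp P ks g fs \<in> opset P (sum_list ks)"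
    and opcomp_opid_left: "f \<in> opset P n \<Longrightarrow> opcomp P [n] (opid P) [f] = f"
    and opcomp_opid_right:
      "f \<in> opset P n \<Longrightarrow> opcomp P (replicate n 1) f (replicate n (opid P)) = f"
    and opcomp_assoc:
      "\<lbrakk>g \<in> opset P (length kss); fs \<in> op_inputs P (map length kss);
        list_all2 (\<lambda>ks hs. hs \<in> op_inputs P ks) kss hss\<rbrakk> \<Longrightarrow>
       opcomp P (concat kss) (opcomp P (map length kss) g fs) (concat hss) =
       opcomp P (map sum_list kss) g
         (map (\<lambda>i. opcomp P (kss ! i) (fs ! i) (hss ! i)) [0..<length kss])"

definition operad_map ::
    "('a, 'm) operad_scheme \<Rightarrow> ('b, 'n) operad_scheme \<Rightarrow> (nat \<Rightarrow> 'a \<Rightarrow> 'b) \<Rightarrow> bool" where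
  "operad_map P Q f \<longleftrightarrow>
     (\<forall>n. f n \<in> opset P n \<rightarrow> opset Q n) \<and>
     f 1 (opid P) = opid Q \<and>
     (\<forall>ks. \<forall>g \<in> opset P (length ks). \<forall>fs \<in> op_inputs P ks.
        f (sum_list ks) (opcomp P ks g fs) = opcomp Q ks (f (length ks) g) (map2 f ks fs))"

text \<open>Operads in the cartesian monoidal category of groups.\<close>

locale group_operad = operad P for P :: "('a, 'm) group_operad_scheme" +
  assumes opgroup_group: "group (opgroup P n)"
    and opid_eq_opone: "opid P = opone P 1"
    and opcomp_hom:
      "\<lbrakk>g \<in> opset P (length ks); g' \<in> opset P (length ks);
        fs \<in> op_inputs P ks; fs' \<in> op_inputs P ks\<rbrakk> \<Longrightarrow>
       opcomp P ks (opmult P (length ks) g g')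
         (map (\<lambda>i. opmult P (ks ! i) (fs ! i) (fs' ! i)) [0..<length ks]) =
       opmult P (sum_list ks) (opcomp P ks g fs) (opcomp P ks g' fs')"

definition block_offset :: "nat list \<Rightarrow> nat \<Rightarrow> nat" where
  "block_offset ks i = sum_list (take i ks)"

definition block_index :: "nat list \<Rightarrow> nat \<Rightarrow> nat" where
  "block_index ks x = (LEAST i. x < block_offset ks (Suc i))"

definition block_sum :: "nat list \<Rightarrow> (nat \<Rightarrow> nat) list \<Rightarrow> nat \<Rightarrow> nat" where
  "block_sum ks ts x =
     (if x < sum_list ks
      then let i = block_index ks x; o\<^sub>i = block_offset ks i in o\<^sub>i + (ts ! i) (x - o\<^sub>i)
      else x)"

definition block_perm :: "nat list \<Rightarrow> (nat \<Rightarrow> nat) \<Rightarrow> nat \<Rightarrow> nat" where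
  "block_perm ks s x =
     (if x < sum_list ks
      then let i = block_index ks x
           in (\<Sum>j | j < length ks \<and> s j < s i. ks ! j) + (x - block_offset ks i)
      else x)"

lemma block_offset_Suc: "i < length ks \<Longrightarrow> block_offset ks (Suc i) = block_offset ks i + ks ! i"
  by (simp add: block_offset_def take_Suc_conv_app_nth)

lemma block_offset_mono: "i \<le> j \<Longrightarrow> block_offset ks i \<le> block_offset ks j"
proof -
  assume "i \<le> j"
  then have "take j ks = take i ks @ take (j - i) (drop i ks)"
    by (metis le_add_diff_inverse take_add)
  then show ?thesis by (simp add: block_offset_def)
qed

lemma block_index_eq:
  assumes "i < length ks" "a < ks ! i"
  shows "block_index ks (block_offset ks i + a) = i"
  unfolding block_index_def
proof (rule Least_equality)
  show "block_offset ks i + a < block_offset ks (Suc i)"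
    using assms by (simp add: block_offset_Suc)
next
  fix j assume "block_offset ks i + a < block_offset ks (Suc j)"
  then show "i \<le> j"
    using block_offset_mono[of "Suc j" i ks] by linarith
qed

lemma block_offset_less:
  assumes "i < length ks" "a < ks ! i"
  shows "block_offset ks i + a < sum_list ks"
  using block_offset_mono[of "Suc i" "length ks" ks] assms
  by (simp add: block_offset_Suc) (simp add: block_offset_def)

text \<open>The defining descriptions of the block sum and of the block permutation.\<close>

lemma block_sum_apply:
  "\<lbrakk>i < length ks; a < ks ! i\<rbrakk> \<Longrightarrow>
   block_sum ks ts (block_offset ks i + a) = block_offset ks i + (ts ! i) a"
  by (simp add: block_sum_def block_offset_less block_index_eq)

lemma block_perm_apply:
  "\<lbrakk>i < length ks; a < ks ! i\<rbrakk> \<Longrightarrow>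
   block_perm ks s (block_offset ks i + a) = (\<Sum>j | j < length ks \<and> s j < s i. ks ! j) + a"
  by (simp add: block_perm_def block_offset_less block_index_eq)

definition sym_operad :: "(nat \<Rightarrow> nat) action_operad" where
  "sym_operad =
     \<lparr>opset = (\<lambda>n. {p. p permutes {..<n}}), opid = id,
      opcomp = (\<lambda>ks s ts. block_perm ks s \<circ> block_sum ks ts),
      opmult = (\<lambda>n p q. p \<circ> q), opone = (\<lambda>n. id), operm = (\<lambda>n p. p)\<rparr>"

locale action_operad = operad L for L :: "'a action_operad" +
  assumes opgroup_group: "group (opgroup L n)"
    and operm_operad_map: "operad_map L sym_operad (operm L)"
    and operm_hom: "operm L n \<in> hom (opgroup L n) (opgroup sym_operad n)"
    and opcomp_opmult:
      "\<lbrakk>g \<in> opset L n; g' \<in> opset L n; length ks = n;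
        ks' = map (\<lambda>i. ks ! operm L n (inv\<^bsub>opgroup L n\<^esub> g) i) [0..<n];
        fs \<in> op_inputs L ks; fs' \<in> op_inputs L ks'\<rbrakk> \<Longrightarrow>
       opmult L (sum_list ks) (opcomp L ks' g' fs') (opcomp L ks g fs) =
       opcomp L ks (opmult L n g' g)
         (map (\<lambda>i. opmult L (ks ! i) (fs' ! operm L n g i) (fs ! i)) [0..<n])"

definition action_operad_map ::
    "'a action_operad \<Rightarrow> 'b action_operad \<Rightarrow> (nat \<Rightarrow> 'a \<Rightarrow> 'b) \<Rightarrow> bool" where
  "action_operad_map L L' f \<longleftrightarrow>
     operad_map L L' f \<and>
     (\<forall>n. \<forall>g \<in> opset L n. operm L' n (f n g) = operm L n g) \<and>
     (\<forall>n. f n \<in> hom (opgroup L n) (opgroup L' n))"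

definition operad_Ker ::
    "'a action_operad \<Rightarrow> 'b action_operad \<Rightarrow> (nat \<Rightarrow> 'a \<Rightarrow> 'b) \<Rightarrow> 'a action_operad" where
  "operad_Ker L L' f = L\<lparr>opset := \<lambda>n. kernel (opgroup L n) (opgroup L' n) (f n)\<rparr>"

definition operad_Im ::
    "'a action_operad \<Rightarrow> 'b action_operad \<Rightarrow> (nat \<Rightarrow> 'a \<Rightarrow> 'b) \<Rightarrow> 'b action_operad" where
  "operad_Im L L' f = L'\<lparr>opset := \<lambda>n. f n ` opset L n\<rparr>"

definition triv_operad :: "unit action_operad" where
  "triv_operad =
     \<lparr>opset = (\<lambda>n. UNIV), opid = (), opcomp = (\<lambda>ks g fs. ()),
      opmult = (\<lambda>n g h. ()), opone = (\<lambda>n. ()), operm = (\<lambda>n g. id)\<rparr>"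

text \<open>
  The condition that \<open>Ker f\<close> is the trivial action operad is stated with the latter embedded
  in \<open>L1\<close> by the unique map \<open>triv_operad \<rightarrow> L1\<close>.
\<close>

definition short_exact_sequence ::
    "'a action_operad \<Rightarrow> 'b action_operad \<Rightarrow> 'c action_operad \<Rightarrow>
     (nat \<Rightarrow> 'a \<Rightarrow> 'b) \<Rightarrow> (nat \<Rightarrow> 'b \<Rightarrow> 'c) \<Rightarrow> bool" where
  "short_exact_sequence L1 L2 L3 f g \<longleftrightarrow>
     action_operad L1 \<and> action_operad L2 \<and> action_operad L3 \<and>
     action_operad_map L1 L2 f \<and> action_operad_map L2 L3 g \<and>
     operad_Ker L1 L2 f = operad_Im triv_operad L1 (\<lambda>n u. opone L1 n) \<and>
     operad_Im L1 L2 f = operad_Ker L2 L3 g \<and>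
     operad_Im L2 L3 g = L3"

definition is_extension ::
    "'b action_operad \<Rightarrow> 'c action_operad \<Rightarrow> 'a action_operad \<Rightarrow> bool" where
  "is_extension L2 L3 L1 \<longleftrightarrow> (\<exists>f g. short_exact_sequence L1 L2 L3 f g)"

text \<open>Action operads that are operads in groups under the usual identification.\<close>

definition is_operad_in_groups :: "'a action_operad \<Rightarrow> bool" where
  "is_operad_in_groups L \<longleftrightarrow>
     action_operad L \<and> group_operad L \<and> (\<forall>n. \<forall>g \<in> opset L n. operm L n g = id)"

end

theory Submission
  imports Defs
begin

text \<open>
  The image of \<open>\<pi>\<close> is a family of subgroups of the symmetric groups closed under operadic
  composition, and such a family is trivial or everything. A nontrivial member \<open>p\<close> inverts some
  pair \<open>i < j\<close>; composing it with identities of arity 1 in the positions \<open>i, j\<close> and of arity 0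
  elsewhere yields the transposition of two letters. Plugging the latter into the middle of
  \<open>e\<^sub>3\<close>, between identities of arities \<open>i\<close> and \<open>n - i - 2\<close>, yields all adjacent transpositions,
  and these generate. If \<open>\<pi>\<close> is trivial, then \<open>\<Lambda> = Ker \<pi>\<close>. The kernel is an
  operad in groups because the mixed interchange law of an action operad loses its twist on
  elements with trivial permutation.
\<close>

section \<open>Blocks\<close>

text \<open>Supplies the block coordinates \<open>(i, a)\<close> in which all pointwise identities
  below are checked. Induction from the right fits because appending an arity leaves the earlier
  offsets unchanged.\<close>

lemma block_decomp:
  assumes "x < sum_list ks"
  obtains i a where "i < length ks" "a < ks ! i" "x = block_offset ks i + a"
  using assms
proof (induction ks arbitrary: x thesis rule: rev_induct)
  case Nil
  then show ?case by simp
next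
  case (snoc k ks)
  show ?case
  proof (cases "x < sum_list ks")
    case True
    then obtain i a where "i < length ks" "a < ks ! i" "x = block_offset ks i + a"
      using snoc.IH by blast
    then show ?thesis
      by (intro snoc.prems(1)[of i a]) (simp_all add: nth_append block_offset_def)
  next
    case False
    with snoc.prems(2) show ?thesis
      by (intro snoc.prems(1)[of "length ks" "x - sum_list ks"]) (simp_all add: block_offset_def)
  qed
qed

lemma block_offset_eq_sum: "i \<le> length ks \<Longrightarrow> block_offset ks i = (\<Sum>j<i. ks ! j)"
  by (simp add: block_offset_def sum_list_sum_nth atLeast0LessThan)

text \<open>Block coordinates are ordered lexicographically, since a later block starts at or after
  the end of an earlier one. This turns comparisons of values of a composite permutation into
  comparisons of its constituents.\<close>

lemma block_less_iff:
  assumes "i < length ks" "a < ks ! i" "j < length ks" "b < ks ! j"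
  shows "block_offset ks i + a < block_offset ks j + b \<longleftrightarrow> i < j \<or> i = j \<and> a < b"
proof (cases i j rule: linorder_cases)
  case less
  then show ?thesis
    using block_offset_mono[of "Suc i" j ks] assms by (simp add: block_offset_Suc)
next
  case equal
  then show ?thesis by simp
next
  case greater
  then show ?thesis
    using block_offset_mono[of "Suc j" i ks] assms by (simp add: block_offset_Suc)
qed

lemma block_eq_iff:
  assumes "i < length ks" "a < ks ! i" "j < length ks" "b < ks ! j"
  shows "block_offset ks i + a = block_offset ks j + b \<longleftrightarrow> i = j \<and> a = b"
  using assms by (metis block_index_eq add_left_cancel)

lemma sum_blocks:
  "(\<Sum>x<sum_list ks. f x) = (\<Sum>i<length ks. \<Sum>a<ks ! i. f (block_offset ks i + a))"
proof (induction ks rule: rev_induct)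
  case Nil
  then show ?case by simp
next
  case (snoc k ks)
  have "(\<Sum>x<sum_list ks + k. f x) = (\<Sum>x<sum_list ks. f x) + (\<Sum>a<k. f (sum_list ks + a))"
    by (induction k) (simp_all add: add.assoc)
  then show ?case
    using snoc.IH by (simp add: nth_append block_offset_def cong: sum.cong_simp)
qed

lemma concat_nth_block:
  assumes "i < length xss" "j < length (xss ! i)"
  shows "concat xss ! (block_offset (map length xss) i + j) = xss ! i ! j"
  using assms
proof (induction xss arbitrary: i)
  case Nil
  then show ?case by simp
next
  case (Cons xs xss)
  then show ?case
    by (cases i) (simp_all add: nth_append block_offset_def)
qed

text \<open>Relates the two levels of blocks that occur in associativity: before entry
  \<open>j\<close> of \<open>kss ! i\<close> come all entries of the earlier lists and the first
  \<open>j\<close> entries of \<open>kss ! i\<close>.\<close>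

lemma block_offset_concat:
  assumes "i < length kss" "j \<le> length (kss ! i)"
  shows "block_offset (concat kss) (block_offset (map length kss) i + j) =
    block_offset (map sum_list kss) i + block_offset (kss ! i) j"
  using assms
proof (induction kss arbitrary: i)
  case Nil
  then show ?case by simp
next
  case (Cons ks kss)
  then show ?case
    by (cases i) (simp_all add: block_offset_def)
qed

lemma sum_list_concat_nat: "sum_list (concat kss) = sum_list (map sum_list (kss :: nat list list))"
  by (induction kss) simp_all

section \<open>The action operad of symmetric groups\<close>

abbreviation perm_comp :: "nat list \<Rightarrow> (nat \<Rightarrow> nat) \<Rightarrow> (nat \<Rightarrow> nat) list \<Rightarrow> nat \<Rightarrow> nat" where
  "perm_comp ks s ts \<equiv> block_perm ks s \<circ> block_sum ks ts"

lemma sym_inputs_iff: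
  "ts \<in> op_inputs sym_operad ks \<longleftrightarrow>
    length ts = length ks \<and> (\<forall>i<length ks. ts ! i permutes {..<ks ! i})"
  by (auto simp: op_inputs_def sym_operad_def list_all2_conv_all_nth)

lemma permutes_less: "p permutes {..<n} \<Longrightarrow> (x :: nat) < n \<Longrightarrow> p x < n"
  using permutes_in_image by fastforce

text \<open>An inner permutation keeps \<open>a\<close> within its block, so
  \<open>block_perm\<close> finds the same index \<open>i\<close> again.\<close>

lemma perm_comp_apply:
  assumes "ts \<in> op_inputs sym_operad ks" "i < length ks" "a < ks ! i"
  shows "perm_comp ks s ts (block_offset ks i + a) =
    (\<Sum>j | j < length ks \<and> s j < s i. ks ! j) + (ts ! i) a"
proof -
  have "(ts ! i) a < ks ! i"
    using assms by (auto simp: sym_inputs_iff intro: permutes_less)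
  then show ?thesis
    using assms by (simp add: block_sum_apply block_perm_apply)
qed

lemma perm_comp_outside: "sum_list ks \<le> x \<Longrightarrow> perm_comp ks s ts x = x"
  by (simp add: block_sum_def block_perm_def)

text \<open>Reindexing along \<open>s\<close>. The map \<open>t\<close> serves two purposes: the
  identity yields offsets in the rearranged list, and a second permutation yields the composition
  law.\<close>

lemma sum_less_perm:
  fixes s :: "nat \<Rightarrow> nat"
  assumes "s permutes {..<n}" "i < n"
  shows "(\<Sum>j | j < n \<and> t (s j) < (t (s i) :: nat). f (s j)) = (\<Sum>j | j < n \<and> t j < t (s i). f j)"
proof (rule sum.reindex_bij_betw[where h = s and g = f])
  show "bij_betw s {j. j < n \<and> t (s j) < t (s i)} {j. j < n \<and> t j < t (s i)}"
    unfolding bij_betw_def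
  proof
    show "inj_on s {j. j < n \<and> t (s j) < t (s i)}"
      using permutes_inj[OF assms(1)] by (rule inj_on_subset) simp
    show "s ` {j. j < n \<and> t (s j) < t (s i)} = {j. j < n \<and> t j < t (s i)}"
    proof (intro equalityI subsetI)
      fix j assume "j \<in> {j. j < n \<and> t j < t (s i)}"
      then have "s (inv_into UNIV s j) = j" "inv_into UNIV s j < n" "t j < t (s i)"
        using permutes_inverses(1)[OF assms(1)] permutes_less[OF permutes_inv[OF assms(1)]] by auto
      then show "j \<in> s ` {j. j < n \<and> t (s j) < t (s i)}"
        by (intro image_eqI[of _ _ "inv_into UNIV s j"]) auto
    qed (use permutes_less[OF assms(1)] in auto)
  qed
qed

text \<open>The arities of the inputs, listed in the order in which \<open>s\<close> arranges the blocks.\<close>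

definition permute_arities :: "(nat \<Rightarrow> nat) \<Rightarrow> nat list \<Rightarrow> nat list" where
  "permute_arities s ks = map (\<lambda>i. ks ! inv_into UNIV s i) [0..<length ks]"

lemma length_permute_arities [simp]: "length (permute_arities s ks) = length ks"
  by (simp add: permute_arities_def)

lemma permute_arities_nth:
  assumes "s permutes {..<length ks}" "i < length ks"
  shows "permute_arities s ks ! s i = ks ! i"
  using assms by (simp add: permute_arities_def permutes_less permutes_inverses)

lemma sum_list_permute_arities:
  assumes "s permutes {..<length ks}"
  shows "sum_list (permute_arities s ks) = sum_list ks"
proof -
  have "sum_list (permute_arities s ks) = (\<Sum>i<length ks. ks ! inv_into UNIV s i)"
    by (simp add: permute_arities_def sum_list_sum_nth atLeast0LessThan)
  also have "\<dots> = (\<Sum>i<length ks. ks ! i)"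
    using sum.permute[OF permutes_inv[OF assms], of "(!) ks"] by (simp add: o_def)
  finally show ?thesis
    by (simp add: sum_list_sum_nth atLeast0LessThan)
qed

text \<open>The blocks that land before block \<open>i\<close> are, after reindexing along
  \<open>s\<close>, those preceding position \<open>s i\<close> in the rearranged list. Source and
  target are thus both in block coordinates, and the lemmas on comparing such coordinates apply to
  values.\<close>

lemma perm_comp_block:
  assumes "s permutes {..<length ks}" "ts \<in> op_inputs sym_operad ks" "i < length ks" "a < ks ! i"
  shows "perm_comp ks s ts (block_offset ks i + a) =
    block_offset (permute_arities s ks) (s i) + (ts ! i) a"
proof -
  have "(\<Sum>j | j < length ks \<and> s j < s i. ks ! j) =
      (\<Sum>j | j < length ks \<and> s j < s i. permute_arities s ks ! s j)"
    using permute_arities_nth[OF assms(1)] by (intro sum.cong) auto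
  also have "\<dots> = (\<Sum>j | j < length ks \<and> j < s i. permute_arities s ks ! j)"
    using sum_less_perm[OF assms(1,3), where t = "\<lambda>x. x" and f = "(!) (permute_arities s ks)"] by simp
  also have "\<dots> = block_offset (permute_arities s ks) (s i)"
    using permutes_less[OF assms(1,3)]
    by (subst block_offset_eq_sum) (auto intro!: sum.cong)
  finally show ?thesis
    using perm_comp_apply[OF assms(2-4)] by simp
qed

text \<open>For a self-map of a finite set injectivity suffices, and it can be read off from the
  block coordinates of the values.\<close>

lemma perm_comp_permutes:
  assumes s: "s permutes {..<length ks}" and ts: "ts \<in> op_inputs sym_operad ks"
  shows "perm_comp ks s ts permutes {..<sum_list ks}"
proof (rule bij_imp_permutes)
  have t: "(ts ! i) a < ks ! i" if "i < length ks" "a < ks ! i" for i a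
    using that ts by (auto simp: sym_inputs_iff intro: permutes_less)
  have "perm_comp ks s ts ` {..<sum_list ks} \<subseteq> {..<sum_list ks}"
  proof (rule image_subsetI)
    fix x assume "x \<in> {..<sum_list ks}"
    then obtain i a where "i < length ks" "a < ks ! i" "x = block_offset ks i + a"
      using block_decomp[of x ks] by auto
    then show "perm_comp ks s ts x \<in> {..<sum_list ks}"
      using block_offset_less[of "s i" "permute_arities s ks" "(ts ! i) a"]
      by (simp add: perm_comp_block[OF s ts, unfolded o_apply] permute_arities_nth[OF s]
          permutes_less[OF s] t sum_list_permute_arities[OF s])
  qed
  moreover have "inj_on (perm_comp ks s ts) {..<sum_list ks}"
  proof (rule inj_onI)
    fix x y assume "x \<in> {..<sum_list ks}" "y \<in> {..<sum_list ks}"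
      and eq: "perm_comp ks s ts x = perm_comp ks s ts y"
    then obtain i a j b where *: "i < length ks" "a < ks ! i" "x = block_offset ks i + a"
        "j < length ks" "b < ks ! j" "y = block_offset ks j + b"
      using block_decomp[of x ks] block_decomp[of y ks] by (metis lessThan_iff)
    then have "s i = s j \<and> (ts ! i) a = (ts ! j) b"
      using eq block_eq_iff[of "s i" "permute_arities s ks" "(ts ! i) a" "s j" "(ts ! j) b"]
      by (simp add: perm_comp_block[OF s ts, unfolded o_apply] permute_arities_nth[OF s]
          permutes_less[OF s] t)
    moreover from this have "i = j"
      using permutes_inj[OF s] by (simp add: inj_eq)
    moreover from this have "inj (ts ! i)"
      using ts * by (auto simp: sym_inputs_iff intro: permutes_inj)
    ultimately show "x = y"
      using * by (auto dest: injD)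
  qed
  ultimately show "bij_betw (perm_comp ks s ts) {..<sum_list ks} {..<sum_list ks}"
    by (intro bij_betw_imageI endo_inj_surj) auto
qed (use perm_comp_outside in auto)

text \<open>The reason why the kernel of \<open>\<pi>\<close> is closed under operadic
  composition.\<close>

lemma perm_comp_id: "perm_comp ks id (replicate (length ks) id) = id"
proof
  fix x
  show "perm_comp ks id (replicate (length ks) id) x = id x"
  proof (cases "x < sum_list ks")
    case True
    then obtain i a where i: "i < length ks" and a: "a < ks ! i" and x: "x = block_offset ks i + a"
      using block_decomp by blast
    have "(\<Sum>j | j < length ks \<and> j < i. ks ! j) = block_offset ks i"
      using i by (subst block_offset_eq_sum) (auto intro!: sum.cong)
    then show ?thesis
      unfolding x using i a
      by (subst perm_comp_apply) (auto simp: sym_inputs_iff permutes_id)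
  qed (use perm_comp_outside in auto)
qed

text \<open>A letter has three coordinates: outer block \<open>i\<close>, inner block
  \<open>j\<close> and position \<open>a\<close>. Both sides add \<open>(hss ! i ! j) a\<close> to
  the total arity of the inner blocks placed earlier, so the proof compares two ways of computing
  that total.\<close>

lemma perm_comp_assoc:
  assumes g: "g permutes {..<length kss}" and fs: "fs \<in> op_inputs sym_operad (map length kss)"
    and hss: "list_all2 (\<lambda>ks hs. hs \<in> op_inputs sym_operad ks) kss hss"
  shows "perm_comp (concat kss) (perm_comp (map length kss) g fs) (concat hss) =
    perm_comp (map sum_list kss) g
      (map (\<lambda>i. perm_comp (kss ! i) (fs ! i) (hss ! i)) [0..<length kss])"
    (is "perm_comp (concat kss) ?G _ = perm_comp _ g ?fs")
proof
  fix x
  have len: "length hss = length kss" "length fs = length kss"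
    using hss fs by (simp_all add: list_all2_lengthD sym_inputs_iff)
  have hs: "hss ! i \<in> op_inputs sym_operad (kss ! i)" if "i < length kss" for i
    using hss that by (simp add: list_all2_conv_all_nth)
  have fsi: "fs ! i permutes {..<length (kss ! i)}" if "i < length kss" for i
    using fs that by (simp add: sym_inputs_iff)
  have lens: "map length hss = map length kss"
    using hs len by (intro nth_equalityI) (simp_all add: sym_inputs_iff)
  have concat_hss: "concat hss \<in> op_inputs sym_operad (concat kss)"
    unfolding sym_inputs_iff
  proof (intro conjI allI impI)
    show "length (concat hss) = length (concat kss)"
      by (simp add: length_concat lens)
    fix J assume "J < length (concat kss)"
    then obtain i j where "i < length kss" "j < length (kss ! i)"
        "J = block_offset (map length kss) i + j"
      using block_decomp[of J "map length kss"] by (auto simp: length_concat)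
    then show "concat hss ! J permutes {..<concat kss ! J}"
      using concat_nth_block[of i hss j] hs[of i] len
      by (simp add: concat_nth_block lens sym_inputs_iff)
  qed
  have fs': "?fs \<in> op_inputs sym_operad (map sum_list kss)"
    using perm_comp_permutes hs fsi by (simp add: sym_inputs_iff)
  show "perm_comp (concat kss) ?G (concat hss) x = perm_comp (map sum_list kss) g ?fs x"
  proof (cases "x < sum_list (concat kss)")
    case False
    then show ?thesis
      using perm_comp_outside[of "concat kss" x] perm_comp_outside[of "map sum_list kss" x]
      by (simp add: sum_list_concat_nat del: o_apply)
  next
    case True
    then obtain i y where i: "i < length kss" and y: "y < sum_list (kss ! i)"
        "x = block_offset (map sum_list kss) i + y"
      using block_decomp[of x "map sum_list kss"] by (auto simp: sum_list_concat_nat)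
    then obtain j a where j: "j < length (kss ! i)" and a: "a < kss ! i ! j"
        "y = block_offset (kss ! i) j + a"
      using block_decomp[of y "kss ! i"] by metis
    let ?I = "block_offset (map length kss) i + j"
    have I: "?I < length (concat kss)"
      using block_offset_less[of i "map length kss" j] i j by (simp add: length_concat)
    have x: "x = block_offset (concat kss) ?I + a"
      using block_offset_concat[of i kss j] i j y(2) a(2) by simp
    \<comment> \<open>The lexicographic order on the targets; injectivity of \<open>g\<close>
      replaces \<open>g i' = g i\<close> by \<open>i' = i\<close>.\<close>
    have less: "?G (block_offset (map length kss) i' + j') < ?G ?I \<longleftrightarrow>
        g i' < g i \<or> i' = i \<and> (fs ! i) j' < (fs ! i) j"
      if "i' < length kss" "j' < length (kss ! i')" for i' j'
    proof -
      have "g i' = g i \<longleftrightarrow> i' = i"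
        using permutes_inj[OF g] by (simp add: inj_eq)
      then show ?thesis
        using that i j g permute_arities_nth[of g "map length kss"]
          permutes_less[OF g] permutes_less[OF fsi]
        by (subst (1 2) perm_comp_block[OF _ fs]) (auto simp: block_less_iff)
    qed
    have "(\<Sum>J | J < length (concat kss) \<and> ?G J < ?G ?I. concat kss ! J) =
        (\<Sum>J<sum_list (map length kss). if ?G J < ?G ?I then concat kss ! J else 0)"
      by (simp add: sum.If_cases length_concat Int_def del: o_apply)
    also have "\<dots> = (\<Sum>i'<length kss. \<Sum>j'<length (kss ! i').
        if g i' < g i \<or> i' = i \<and> (fs ! i) j' < (fs ! i) j then kss ! i' ! j' else 0)"
      unfolding sum_blocks using less
      by (intro sum.cong) (simp_all add: concat_nth_block del: o_apply)
    \<comment> \<open>The two alternatives exclude each other: an outer block placed before block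
      \<open>i\<close> counts in full, and block \<open>i\<close> itself counts only through its
      inner blocks placed before \<open>j\<close>.\<close>
    also have "\<dots> = (\<Sum>i'<length kss. (if g i' < g i then sum_list (kss ! i') else 0) +
        (if i' = i then \<Sum>j' | j' < length (kss ! i) \<and> (fs ! i) j' < (fs ! i) j. kss ! i ! j' else 0))"
      by (intro sum.cong)
        (auto simp: sum.If_cases Int_def sum_list_sum_nth atLeast0LessThan intro!: sum.cong)
    also have "\<dots> = (\<Sum>i' | i' < length kss \<and> g i' < g i. sum_list (kss ! i')) +
        (\<Sum>j' | j' < length (kss ! i) \<and> (fs ! i) j' < (fs ! i) j. kss ! i ! j')"
      using i by (simp add: sum.distrib sum.If_cases Int_def)
    finally have sum: "(\<Sum>J | J < length (concat kss) \<and> ?G J < ?G ?I. concat kss ! J) = \<dots>" .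
    have nth: "concat kss ! ?I = kss ! i ! j" "concat hss ! ?I = hss ! i ! j"
      using concat_nth_block[of i kss j] concat_nth_block[of i hss j] i j len hs[OF i]
      by (simp_all add: lens sym_inputs_iff)
    have "perm_comp (concat kss) ?G (concat hss) x =
        (\<Sum>J | J < length (concat kss) \<and> ?G J < ?G ?I. concat kss ! J) + (hss ! i ! j) a"
      unfolding x using perm_comp_apply[OF concat_hss I] a nth by (simp del: o_apply)
    \<comment> \<open>The contribution of block \<open>i\<close> together with
      \<open>(hss ! i ! j) a\<close> is the value of the \<open>i\<close>-th inner composite at
      \<open>y\<close>.\<close>
    also have "\<dots> = (\<Sum>i' | i' < length kss \<and> g i' < g i. sum_list (kss ! i')) +
        perm_comp (kss ! i) (fs ! i) (hss ! i) y"
      unfolding a(2) sum using perm_comp_apply[OF hs[OF i] j a(1)] by (simp del: o_apply)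
    also have "\<dots> = perm_comp (map sum_list kss) g ?fs x"
      unfolding y(2) using perm_comp_apply[OF fs', of i y g] i y(1)
      by (simp del: o_apply cong: conj_cong)
    finally show ?thesis .
  qed
qed

text \<open>The interchange law with its twist: \<open>g\<close> moves block \<open>i\<close> to
  position \<open>g i\<close>, where the second factor acts on it by \<open>fs' ! g i\<close>. The
  arities met by the second factor are therefore the rearranged ones.\<close>

lemma perm_comp_comp:
  assumes g: "g permutes {..<length ks}" and g': "g' permutes {..<length ks}"
    and fs: "fs \<in> op_inputs sym_operad ks"
    and fs': "fs' \<in> op_inputs sym_operad (permute_arities g ks)"
  shows "perm_comp (permute_arities g ks) g' fs' \<circ> perm_comp ks g fs =
    perm_comp ks (g' \<circ> g) (map (\<lambda>i. fs' ! g i \<circ> fs ! i) [0..<length ks])"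
    (is "_ = perm_comp ks _ ?fs")
proof
  fix x
  have nth: "permute_arities g ks ! g i = ks ! i" "g i < length ks" if "i < length ks" for i
    using that by (simp_all add: permute_arities_nth[OF g] permutes_less[OF g])
  have fs'': "?fs \<in> op_inputs sym_operad ks"
    using fs fs' nth by (force simp: sym_inputs_iff intro: permutes_compose)
  show "(perm_comp (permute_arities g ks) g' fs' \<circ> perm_comp ks g fs) x = perm_comp ks (g' \<circ> g) ?fs x"
  proof (cases "x < sum_list ks")
    case False
    then show ?thesis
      using perm_comp_outside[of ks x] perm_comp_outside[of "permute_arities g ks" x]
      by (simp add: sum_list_permute_arities[OF g])
  next
    case True
    then obtain i a where i: "i < length ks" and a: "a < ks ! i" and x: "x = block_offset ks i + a"
      using block_decomp by blast
    have f: "(fs ! i) a < ks ! i"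
      using fs i a by (auto simp: sym_inputs_iff intro: permutes_less)
    have "(perm_comp (permute_arities g ks) g' fs' \<circ> perm_comp ks g fs) x =
        perm_comp (permute_arities g ks) g' fs' (block_offset (permute_arities g ks) (g i) + (fs ! i) a)"
      unfolding x using perm_comp_block[OF g fs i a] by simp
    also have "\<dots> = (\<Sum>j | j < length ks \<and> g' j < g' (g i). permute_arities g ks ! j) +
        (fs' ! g i) ((fs ! i) a)"
      using perm_comp_apply[OF fs', of "g i" "(fs ! i) a" g'] nth[OF i] f by simp
    also have "(\<Sum>j | j < length ks \<and> g' j < g' (g i). permute_arities g ks ! j) =
        (\<Sum>j | j < length ks \<and> (g' \<circ> g) j < (g' \<circ> g) i. ks ! j)"
      using sum_less_perm[OF g i, where t = g' and f = "(!) (permute_arities g ks)"] nth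
      by (simp cong: conj_cong sum.cong_simp)
    finally show ?thesis
      unfolding x using perm_comp_apply[OF fs'' i a, of "g' \<circ> g"] i by simp
  qed
qed

section \<open>The action operad axioms for the symmetric groups\<close>

lemma sym_operad_simps [simp]:
  "opset sym_operad n = {p. p permutes {..<n}}" "opid sym_operad = id"
  "opcomp sym_operad ks s ts = perm_comp ks s ts"
  "opmult sym_operad n p q = p \<circ> q" "opone sym_operad n = id" "operm sym_operad n p = p"
  by (simp_all add: sym_operad_def)

lemma opgroup_simps [simp]:
  "carrier (opgroup P n) = opset P n" "x \<otimes>\<^bsub>opgroup P n\<^esub> y = opmult P n x y"
  "\<one>\<^bsub>opgroup P n\<^esub> = opone P n"
  by (simp_all add: opgroup_def)

lemma group_sym: "group (opgroup sym_operad n)"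
  by (rule groupI)
    (auto intro: permutes_compose permutes_id permutes_inv exI[of _ "inv_into UNIV _"]
      simp: permutes_inv_o o_assoc intro!: bexI[of _ "inv_into UNIV _"])

lemma inv_sym: "p permutes {..<n} \<Longrightarrow> inv\<^bsub>opgroup sym_operad n\<^esub> p = inv_into UNIV p"
  by (rule group.inv_equality[OF group_sym]) (simp_all add: permutes_inv_o permutes_inv)

lemma operad_sym: "operad sym_operad"
proof
  fix f :: "nat \<Rightarrow> nat" and n
  assume "f \<in> opset sym_operad n"
  then have f: "f permutes {..<n}" by simp
  show "opcomp sym_operad [n] (opid sym_operad) [f] = f"
  proof
    fix x
    show "opcomp sym_operad [n] (opid sym_operad) [f] x = f x"
      using perm_comp_apply[of "[f]" "[n]" 0 x id] perm_comp_outside[of "[n]" x id "[f]"] f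
        permutes_not_in[OF f, of x]
      by (cases "x < n") (simp_all add: sym_inputs_iff block_offset_def)
  qed
  show "opcomp sym_operad (replicate n 1) f (replicate n (opid sym_operad)) = f"
  proof
    fix x
    show "opcomp sym_operad (replicate n 1) f (replicate n (opid sym_operad)) x = f x"
    proof (cases "x < n")
      case True
      \<comment> \<open>With all arities equal to 1 the sum counts the letters whose value lies
        below \<open>f x\<close>; as \<open>f\<close> is a permutation, there are \<open>f x\<close>
        of them.\<close>
      have "(\<Sum>j | j < n \<and> f j < f x. replicate n 1 ! j) = (\<Sum>j | j < n \<and> f j < f x. 1 :: nat)"
        by (intro sum.cong) auto
      also have "\<dots> = (\<Sum>j | j < n \<and> j < f x. 1)"
        using sum_less_perm[OF f True, where t = "\<lambda>x. x" and f = "\<lambda>_. 1 :: nat"] by simp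
      also have "\<dots> = f x"
        using permutes_less[OF f True] by (auto intro!: trans[OF arg_cong[where f = card] card_lessThan])
      finally show ?thesis
        using perm_comp_apply[of "replicate n id" "replicate n 1" x 0 f] True
        by (simp add: sym_inputs_iff block_offset_def permutes_id min_def sum_list_replicate)
    next
      case False
      then show ?thesis
        using perm_comp_outside[of "replicate n 1" x f] permutes_not_in[OF f, of x]
        by (simp add: sum_list_replicate)
    qed
  qed
qed (use perm_comp_permutes perm_comp_assoc in \<open>simp_all add: permutes_id del: o_apply\<close>)

lemma action_operad_sym: "action_operad sym_operad"
proof (intro action_operad.intro action_operad_axioms.intro)
  show "operad sym_operad" by (fact operad_sym)
  show "group (opgroup sym_operad n)" for n by (fact group_sym)
  show "operad_map sym_operad sym_operad (operm sym_operad)"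
    by (auto simp: operad_map_def sym_inputs_iff map2_map_map intro!: nth_equalityI arg_cong[where f = "perm_comp _ _"])
  show "operm sym_operad n \<in> hom (opgroup sym_operad n) (opgroup sym_operad n)" for n
    by (simp add: hom_def)
next
  fix g g' n ks ks' fs fs'
  assume g: "g \<in> opset sym_operad n" "g' \<in> opset sym_operad n" "length ks = n"
    "ks' = map (\<lambda>i. ks ! operm sym_operad n (inv\<^bsub>opgroup sym_operad n\<^esub> g) i) [0..<n]"
    and fs: "fs \<in> op_inputs sym_operad ks" "fs' \<in> op_inputs sym_operad ks'"
  then have "ks' = permute_arities g ks"
    by (simp add: inv_sym permute_arities_def)
  then show "opmult sym_operad (sum_list ks) (opcomp sym_operad ks' g' fs') (opcomp sym_operad ks g fs) =
       opcomp sym_operad ks (opmult sym_operad n g' g)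
         (map (\<lambda>i. opmult sym_operad (ks ! i) (fs' ! operm sym_operad n g i) (fs ! i)) [0..<n])"
    using perm_comp_comp[of g ks g' fs fs'] g fs by simp
qed

section \<open>The kernel and the image of the underlying permutations\<close>

text \<open>The least moved point \<open>x\<close> and its preimage \<open>y\<close> are inverted:
  all smaller points are fixed, so both \<open>y\<close> and \<open>p x\<close> exceed
  \<open>x = p y\<close>.\<close>

lemma exists_inversion:
  fixes p :: "nat \<Rightarrow> nat"
  assumes p: "p permutes {..<n}" and "p \<noteq> id"
  obtains i j where "i < j" "j < n" "p j < p i"
proof -
  define x where "x = (LEAST x. p x \<noteq> x)"
  have x: "p x \<noteq> x"
    unfolding x_def by (rule LeastI_ex[where P = "\<lambda>x. p x \<noteq> x"]) (use \<open>p \<noteq> id\<close> in \<open>auto simp: fun_eq_iff\<close>)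
  have fix_below: "p y = y" if "y < x" for y
    using not_less_Least[of y "\<lambda>x. p x \<noteq> x"] that unfolding x_def by blast
  obtain y where y: "p y = x"
    using permutes_surj[OF p] by (metis surjD)
  have "x < y"
    using fix_below[of y] x y by (metis linorder_neqE_nat)
  moreover have "x < p x"
    using fix_below[of "p x"] x permutes_inj[OF p] by (metis injD linorder_neqE_nat)
  moreover have "y < n"
    using permutes_not_in[OF p, of y] y \<open>x < y\<close> by fastforce
  ultimately show ?thesis
    using that y by blast
qed

lemma map2_snd: "length xs = length ks \<Longrightarrow> map2 (\<lambda>k x. x) ks xs = xs"
  by (intro nth_equalityI) simp_all

lemma op_inputs_iff:
  "fs \<in> op_inputs P ks \<longleftrightarrow> length fs = length ks \<and> (\<forall>i<length ks. fs ! i \<in> opset P (ks ! i))"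
  by (auto simp: op_inputs_def list_all2_conv_all_nth)

lemma operad_Ker_simps [simp]:
  "opset (operad_Ker L L' f) n = {g \<in> opset L n. f n g = opone L' n}"
  "opid (operad_Ker L L' f) = opid L" "opcomp (operad_Ker L L' f) = opcomp L"
  "opmult (operad_Ker L L' f) = opmult L" "opone (operad_Ker L L' f) = opone L"
  "operm (operad_Ker L L' f) = operm L"
  by (simp_all add: operad_Ker_def kernel_def)

section \<open>Consequences of the action operad axioms\<close>

context action_operad
begin

lemma opone_closed: "opone L n \<in> opset L n"
  using group.is_monoid[OF opgroup_group, THEN monoid.one_closed] by simp

lemma opmult_closed: "g \<in> opset L n \<Longrightarrow> h \<in> opset L n \<Longrightarrow> opmult L n g h \<in> opset L n"
  using group.is_monoid[OF opgroup_group, THEN monoid.m_closed, of g n h] by simp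

lemma opmult_opone:
  assumes "g \<in> opset L n"
  shows "opmult L n g (opone L n) = g" "opmult L n (opone L n) g = g"
  using group.is_monoid[OF opgroup_group, THEN monoid.r_one, of g n]
    group.is_monoid[OF opgroup_group, THEN monoid.l_one, of g n] assms by simp_all

lemma operm_permutes: "g \<in> opset L n \<Longrightarrow> operm L n g permutes {..<n}"
  using operm_operad_map by (auto simp: operad_map_def)

lemma operm_opid: "operm L 1 (opid L) = id"
  using operm_operad_map by (simp add: operad_map_def)

lemma operm_opcomp:
  assumes "g \<in> opset L (length ks)" "fs \<in> op_inputs L ks"
  shows "operm L (sum_list ks) (opcomp L ks g fs) =
    perm_comp ks (operm L (length ks) g) (map2 (operm L) ks fs)"
  using operm_operad_map assms by (simp add: operad_map_def)

lemma operm_opmult: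
  "g \<in> opset L n \<Longrightarrow> h \<in> opset L n \<Longrightarrow> operm L n (opmult L n g h) = operm L n g \<circ> operm L n h"
  using operm_hom[of n] by (simp add: hom_def)

lemma operm_group_hom: "group_hom (opgroup L n) (opgroup sym_operad n) (operm L n)"
  by (intro group_hom.intro group_hom_axioms.intro opgroup_group group_sym operm_hom)

lemma operm_opone: "operm L n (opone L n) = id"
  using group_hom.hom_one[OF operm_group_hom, of n] by simp

lemma operm_inv:
  assumes "g \<in> opset L n"
  shows "operm L n (inv\<^bsub>opgroup L n\<^esub> g) = inv_into UNIV (operm L n g)"
  using group_hom.hom_inv[OF operm_group_hom, of g n] inv_sym[OF operm_permutes] assms by simp

text \<open>The axiom twists by the permutation of the right factor \<open>g\<close> alone. If this
  is the identity, the arity list \<open>ks'\<close> of the axiom is \<open>ks\<close> and the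
  inputs \<open>fs'\<close> keep their order.\<close>

lemma opcomp_opmult_trivial_perm:
  assumes "g \<in> opset L (length ks)" "g' \<in> opset L (length ks)" "operm L (length ks) g = id"
    "fs \<in> op_inputs L ks" "fs' \<in> op_inputs L ks"
  shows "opmult L (sum_list ks) (opcomp L ks g' fs') (opcomp L ks g fs) =
    opcomp L ks (opmult L (length ks) g' g)
      (map (\<lambda>i. opmult L (ks ! i) (fs' ! i) (fs ! i)) [0..<length ks])"
  using opcomp_opmult[of g "length ks" g' ks ks fs fs'] assms
  by (simp add: operm_inv inv_id map_nth)

lemma operm_arity_1: "g \<in> opset L 1 \<Longrightarrow> operm L 1 g = id"
  using operm_permutes[of g 1] by (simp add: lessThan_Suc permutes_sing)

text \<open>Eckmann--Hilton: on \<open>L 1\<close> the operad composition is a homomorphism with unit \<open>opid L\<close>.\<close>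

lemma opid_eq_opone: "opid L = opone L 1"
proof -
  let ?e = "opone L 1" and ?u = "opid L"
  have in1: "?e \<in> opset L 1" "?u \<in> opset L 1"
    by (rule opone_closed, rule opid_closed)
  have "?e = opmult L 1 (opcomp L [1] ?u [?e]) (opcomp L [1] ?e [?u])"
    using opcomp_opid_left[OF in1(1)] opcomp_opid_right[OF in1(1)] opmult_opone(1)[OF in1(1)] by simp
  also have "\<dots> = opcomp L [1] (opmult L 1 ?u ?e) [opmult L 1 ?e ?u]"
    using opcomp_opmult_trivial_perm[of ?e "[1]" ?u "[?u]" "[?e]"] in1 operm_arity_1[OF in1(1)]
    by (simp add: op_inputs_iff)
  also have "\<dots> = ?u"
    using opcomp_opid_left[OF in1(2)] opmult_opone[OF in1(2)] by simp
  finally show ?thesis by simp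
qed

section \<open>The kernel of \<open>\<pi>\<close>\<close>

abbreviation pure :: "'a action_operad" where
  "pure \<equiv> operad_Ker L sym_operad (operm L)"

lemma pure_inputs: "fs \<in> op_inputs pure ks \<Longrightarrow> fs \<in> op_inputs L ks"
  by (simp add: op_inputs_iff)

lemma pure_inputs_operm:
  assumes "fs \<in> op_inputs pure ks"
  shows "map2 (operm L) ks fs = replicate (length ks) id"
  using assms by (intro nth_equalityI) (simp_all add: op_inputs_iff)

text \<open>Units and associativity are inherited from \<open>L\<close>; closure holds because a
  composite of identity permutations is the identity.\<close>

lemma operad_pure: "operad pure"
proof
  fix g ks fs
  assume "g \<in> opset pure (length ks)" "fs \<in> op_inputs pure ks"
  then show "opcomp pure ks g fs \<in> opset pure (sum_list ks)"
    using opcomp_closed[of g ks fs] operm_opcomp[of g ks fs] perm_comp_id[of ks]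
    by (simp add: pure_inputs pure_inputs_operm)
next
  fix g kss fs hss
  assume "g \<in> opset pure (length kss)" "fs \<in> op_inputs pure (map length kss)"
    and "list_all2 (\<lambda>ks hs. hs \<in> op_inputs pure ks) kss hss"
  moreover from this(3) have "list_all2 (\<lambda>ks hs. hs \<in> op_inputs L ks) kss hss"
    using pure_inputs by (rule list_all2_mono)
  ultimately show "opcomp pure (concat kss) (opcomp pure (map length kss) g fs) (concat hss) =
       opcomp pure (map sum_list kss) g
         (map (\<lambda>i. opcomp pure (kss ! i) (fs ! i) (hss ! i)) [0..<length kss])"
    using opcomp_assoc pure_inputs by simp
qed (use opid_closed operm_opid opcomp_opid_left opcomp_opid_right in simp_all)

lemma group_pure: "group (opgroup pure n)"
proof -
  have "opgroup pure n = (opgroup L n)\<lparr>carrier := kernel (opgroup L n) (opgroup sym_operad n) (operm L n)\<rparr>"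
    by (simp add: opgroup_def kernel_def)
  then show ?thesis
    using subgroup.subgroup_is_group[OF group_hom.subgroup_kernel[OF operm_group_hom] opgroup_group]
    by simp
qed

lemma action_operad_pure: "action_operad pure"
proof (intro action_operad.intro action_operad_axioms.intro operad_pure group_pure)
  show "operad_map pure sym_operad (operm pure)"
    using operm_opid operm_permutes operm_opcomp pure_inputs by (auto simp: operad_map_def)
  show "operm pure n \<in> hom (opgroup pure n) (opgroup sym_operad n)" for n
    using operm_opmult operm_permutes by (simp add: hom_def)
next
  fix g g' n ks ks' fs fs'
  assume g: "g \<in> opset pure n" "g' \<in> opset pure n" "length ks = n"
    "ks' = map (\<lambda>i. ks ! operm pure n (inv\<^bsub>opgroup pure n\<^esub> g) i) [0..<n]"
    and fs: "fs \<in> op_inputs pure ks" "fs' \<in> op_inputs pure ks'"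
  \<comment> \<open>This inverse is formed in the kernel, so it lies there and has trivial
    permutation; no comparison with the inverse in \<open>L\<close> is involved.\<close>
  have "operm L n (inv\<^bsub>opgroup pure n\<^esub> g) = id"
    using group.inv_closed[OF group_pure, of g n] g(1) by simp
  then have "ks' = ks"
    using g map_nth[of ks] by simp
  then show "opmult pure (sum_list ks) (opcomp pure ks' g' fs') (opcomp pure ks g fs) =
       opcomp pure ks (opmult pure n g' g)
         (map (\<lambda>i. opmult pure (ks ! i) (fs' ! operm pure n g i) (fs ! i)) [0..<n])"
    using opcomp_opmult_trivial_perm[of g ks g' fs fs'] g fs pure_inputs by simp
qed

lemma pure_is_operad_in_groups: "is_operad_in_groups pure"
  unfolding is_operad_in_groups_def
proof (intro conjI allI ballI action_operad_pure group_operad.intro group_operad_axioms.intro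
    operad_pure group_pure)
  show "opid pure = opone pure 1"
    by (simp add: opid_eq_opone)
  fix g g' :: 'a and ks fs fs'
  assume "g \<in> opset pure (length ks)" "g' \<in> opset pure (length ks)"
    "fs \<in> op_inputs pure ks" "fs' \<in> op_inputs pure ks"
  then show "opcomp pure ks (opmult pure (length ks) g g')
         (map (\<lambda>i. opmult pure (ks ! i) (fs ! i) (fs' ! i)) [0..<length ks]) =
       opmult pure (sum_list ks) (opcomp pure ks g fs) (opcomp pure ks g' fs')"
    using opcomp_opmult_trivial_perm[of g' ks g fs' fs] pure_inputs by simp
qed simp

text \<open>Surjectivity enters only in the last equality, that the image of \<open>\<pi>\<close> is
  all of \<open>sym_operad\<close>. The conditions are equations between records, so the operations
  are compared along with the underlying sets.\<close>

lemma pure_short_exact: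
  assumes "\<forall>n. operm L n ` opset L n = opset sym_operad n"
  shows "short_exact_sequence pure L sym_operad (\<lambda>n g. g) (operm L)"
  unfolding short_exact_sequence_def
proof (intro conjI action_operad_pure action_operad_sym)
  show "action_operad L" by unfold_locales
  show "action_operad_map pure L (\<lambda>n g. g)"
    by (auto simp: action_operad_map_def operad_map_def hom_def map2_snd op_inputs_iff)
  show "action_operad_map L sym_operad (operm L)"
    using operm_operad_map operm_hom by (simp add: action_operad_map_def)
  show "operad_Ker pure L (\<lambda>n g. g) = operad_Im triv_operad pure (\<lambda>n u. opone pure n)"
    using opone_closed operm_opone
    by (auto simp: operad_Ker_def operad_Im_def kernel_def triv_operad_def fun_eq_iff
        intro!: action_operad.equality)
  show "operad_Im pure L (\<lambda>n g. g) = pure"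
    by (simp add: operad_Ker_def operad_Im_def)
  show "operad_Im L sym_operad (operm L) = sym_operad"
    using assms by (auto simp: operad_Im_def intro!: action_operad.equality ext)
qed

section \<open>The image of \<open>\<pi>\<close>\<close>

abbreviation perm_image :: "nat \<Rightarrow> (nat \<Rightarrow> nat) set" where
  "perm_image n \<equiv> operm L n ` opset L n"

lemma perm_image_permutes: "p \<in> perm_image n \<Longrightarrow> p permutes {..<n}"
  using operm_permutes by blast

lemma id_in_perm_image: "id \<in> perm_image n"
  using operm_opone opone_closed by (metis imageI)

lemma comp_in_perm_image: "p \<in> perm_image n \<Longrightarrow> q \<in> perm_image n \<Longrightarrow> p \<circ> q \<in> perm_image n"
  using operm_opmult opmult_closed by (auto simp: image_iff) metis

lemma perm_comp_in_perm_image: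
  assumes "s \<in> perm_image (length ks)" "length ts = length ks"
    "\<And>i. i < length ks \<Longrightarrow> ts ! i \<in> perm_image (ks ! i)"
  shows "perm_comp ks s ts \<in> perm_image (sum_list ks)"
proof -
  obtain g where g: "g \<in> opset L (length ks)" "s = operm L (length ks) g"
    using assms(1) by blast
  obtain f where f: "\<And>i. i < length ks \<Longrightarrow> f i \<in> opset L (ks ! i) \<and> ts ! i = operm L (ks ! i) (f i)"
    using assms(3) unfolding image_iff by metis
  let ?fs = "map f [0..<length ks]"
  have fs: "?fs \<in> op_inputs L ks"
    using f by (simp add: op_inputs_iff)
  have "map2 (operm L) ks ?fs = ts"
    using f assms(2) by (intro nth_equalityI) simp_all
  then have "perm_comp ks s ts = operm L (sum_list ks) (opcomp L ks g ?fs)"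
    using operm_opcomp[OF g(1) fs] g(2) by simp
  then show ?thesis
    using opcomp_closed[OF g(1) fs] by blast
qed

lemma swap_in_perm_image_2:
  assumes "p \<in> perm_image n" "p \<noteq> id"
  shows "transpose 0 1 \<in> perm_image 2"
proof -
  have p: "p permutes {..<n}"
    using assms(1) by (rule perm_image_permutes)
  obtain i j where ij: "i < j" "j < n" "p j < p i"
    using exists_inversion[OF p assms(2)] .
  define ks :: "nat list" where "ks = map (\<lambda>k. if k \<in> {i, j} then 1 else 0) [0..<n]"
  let ?q = "perm_comp ks p (replicate n id)"
  have len: "length ks = n" and nth: "\<And>k. k < n \<Longrightarrow> ks ! k = (if k \<in> {i, j} then 1 else 0)"
    by (simp_all add: ks_def)
  have "sum_list ks = (\<Sum>k<n. if k \<in> {i, j} then 1 else 0)"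
    using nth by (simp add: sum_list_sum_nth len atLeast0LessThan)
  also have "\<dots> = card ({..<n} \<inter> {i, j})"
    using sum.inter_restrict[of "{..<n}" "\<lambda>_. 1 :: nat" "{i, j}"] by simp
  also have "{..<n} \<inter> {i, j} = {i, j}"
    using ij by auto
  finally have sum: "sum_list ks = 2"
    using ij by simp
  have q: "?q \<in> perm_image 2"
    using perm_comp_in_perm_image[of p ks "replicate n id"] assms(1) id_in_perm_image
    by (simp add: len sum)
  \<comment> \<open>Positions before \<open>i\<close> have arity 0, so letter 0 of the composite is
    the single letter of block \<open>i\<close>.\<close>
  have "block_offset ks i = 0"
    using ij nth by (simp add: block_offset_eq_sum len)
  then have "?q 0 = (\<Sum>k | k < n \<and> p k < p i. ks ! k)"
    using perm_comp_apply[of "replicate n id" ks i 0 p] ij nth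
    by (simp add: len sym_inputs_iff permutes_id)
  \<comment> \<open>By the inversion, block \<open>j\<close> lands before block \<open>i\<close> and
    contributes its arity 1; hence letter 0 is moved.\<close>
  also have "\<dots> \<ge> ks ! j"
    using ij by (intro member_le_sum) auto
  finally have "?q 0 \<noteq> 0"
    using nth ij by simp
  then have "?q \<noteq> id"
    by (metis id_apply)
  moreover have "?q permutes {..<2}"
    using q by (rule perm_image_permutes)
  moreover have "{..<2} = {0, 1 :: nat}"
    by auto
  ultimately have "?q = transpose 0 1"
    by (metis permutes_doubleton_iff)
  with q show ?thesis by simp
qed

lemma adjacent_transpose_in_perm_image:
  assumes "transpose 0 1 \<in> perm_image 2" "Suc i < n"
  shows "transpose i (Suc i) \<in> perm_image n"
proof -
  let ?ks = "[i, 2, n - i - 2]" and ?ts = "[id, transpose 0 1, id]"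
  \<comment> \<open>The truncated subtraction in \<open>?ks\<close> is exact because
    \<open>Suc i < n\<close>.\<close>
  have sum: "sum_list ?ks = n"
    using assms(2) by simp
  have ts: "?ts \<in> op_inputs sym_operad ?ks"
    using permutes_swap_id[of 0 "{..<2 :: nat}" 1]
    by (simp add: sym_inputs_iff permutes_id nth_Cons' numeral_3_eq_3 All_less_Suc2)
  have "perm_comp ?ks id ?ts x = transpose i (Suc i) x" for x
  proof (cases "x < n")
    case True
    then obtain k a where k: "k < length ?ks" and a: "a < ?ks ! k" and x: "x = block_offset ?ks k + a"
      using block_decomp[of x ?ks] sum by metis
    have "permute_arities id ?ks = ?ks"
      unfolding permute_arities_def by (simp add: inv_id map_nth)
    then have "perm_comp ?ks id ?ts x = block_offset ?ks k + (?ts ! k) a"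
      unfolding x using perm_comp_block[OF _ ts k a, of id] by (simp add: permutes_id)
    moreover have "k = 0 \<or> k = 1 \<or> k = 2"
      using k by auto
    ultimately show ?thesis
      unfolding x using a by (auto simp: block_offset_def transpose_def)
  next
    case False
    then show ?thesis
      using perm_comp_outside[of ?ks x] sum assms(2) by (simp add: transpose_def)
  qed
  then have "perm_comp ?ks id ?ts = transpose i (Suc i)" ..
  moreover have "perm_comp ?ks id ?ts \<in> perm_image (sum_list ?ks)"
    using assms(1) id_in_perm_image
    by (intro perm_comp_in_perm_image) (simp_all add: nth_Cons')
  ultimately show ?thesis
    unfolding sum by simp
qed

text \<open>A nontrivial permutation in a single arity \<open>m\<close> fills every arity
  \<open>n\<close>, because the swap it produces in arity 2 can be planted anywhere.\<close>

lemma perm_image_full: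
  assumes "p \<in> perm_image m" "p \<noteq> id"
  shows "perm_image n = {q. q permutes {..<n}}"
proof
  show "perm_image n \<subseteq> {q. q permutes {..<n}}"
    using perm_image_permutes by blast
  note adjacent = adjacent_transpose_in_perm_image[OF swap_in_perm_image_2[OF assms]]
  have less: "transpose a b \<in> perm_image n" if "a < b" "b < n" for a b
    using that
  proof (induction b)
    case (Suc b)
    show ?case
    proof (cases "a = b")
      case True
      then show ?thesis
        using adjacent Suc.prems by simp
    next
      case False
      \<comment> \<open>Conjugating an adjacent transposition by \<open>transpose a b\<close>
        extends the range of the swap by one.\<close>
      then have "transpose a b \<circ> transpose b (Suc b) \<circ> transpose a b = transpose a (Suc b)"
        using Suc.prems by (intro transpose_comp_triple) auto
      moreover have "transpose a b \<in> perm_image n"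
        using Suc False by simp
      ultimately show ?thesis
        using adjacent[of b n] Suc.prems comp_in_perm_image by metis
    qed
  qed simp
  show "{q. q permutes {..<n}} \<subseteq> perm_image n"
  proof
    fix q assume "q \<in> {q. q permutes {..<n}}"
    then have "q permutes {..<n}" "finite {..<n}" by simp_all
    then show "q \<in> perm_image n"
    proof (induction rule: permutes_induct)
      case (swap a b q)
      then have "transpose a b \<in> perm_image n"
        using less[of a b] less[of b a] by (metis lessThan_iff linorder_neqE_nat transpose_commute)
      with swap show ?case
        using comp_in_perm_image by blast
    qed (rule id_in_perm_image)
  qed
qed

end

theorem corollary6p8:
  fixes L :: "'a action_operad"
  assumes "action_operad L"
  shows "((\<forall>n. operm L n ` opset L n = opset sym_operad n) \<longrightarrow>
          short_exact_sequence (operad_Ker L sym_operad (operm L)) L sym_operad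
            (\<lambda>n g. g) (operm L)) \<and>
         (is_operad_in_groups L \<or>
          (\<exists>K :: 'a action_operad. is_operad_in_groups K \<and> is_extension L sym_operad K))"
proof -
  interpret action_operad L by fact
  show ?thesis
  proof (cases "\<forall>n. \<forall>g \<in> opset L n. operm L n g = id")
    case True
    \<comment> \<open>Here the kernel is everything, so \<open>L\<close> inherits the structure of
      an operad in groups from \<open>pure\<close>.\<close>
    then have "pure = L"
      by (auto simp: operad_Ker_def kernel_def intro!: action_operad.equality ext)
    then show ?thesis
      using pure_short_exact pure_is_operad_in_groups by simp
  next
    case False
    \<comment> \<open>A single element with nontrivial permutation, in whatever arity, makes every
      \<open>\<pi>\<close> component surjective.\<close>
    then have "\<forall>n. perm_image n = opset sym_operad n"
      using perm_image_full by (metis image_eqI sym_operad_simps(1))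
    then show ?thesis
      using pure_short_exact pure_is_operad_in_groups unfolding is_extension_def by blast
  qed
qed

end
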